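(* Let $x^\dagger$ satisfy the source condition: there is $w\in Y$ with $\xi:=A^*w\in\partial\mathcal R(x^\dagger)$. For noisy data $y^\delta$ with $\|y^\delta-y\|\le\delta$, let $\alpha_*=\alpha_*(y^\delta)$ be selected by the heuristic discrepancy rule, i.e. $\alpha_*\in\operatorname{argmin}_{\alpha\in(0,\alpha_{\max})}\frac1\alpha\|y^\delta-Ax_\alpha^\delta\|^2$, and suppose $\delta^*:=\|Ax^\delta_{\alpha_*}-y^\delta\|\neq 0$. Assume that there is a constant $C>0$ such that the auto-regularisation condition $$D_{\xi_\alpha}(x_\alpha^\delta,x_\alpha)\le C\,\frac{\|\Delta p_\alpha\|^2}{\alpha}$$ holds for all $\alpha\in(0,\alpha_{\max})$ and $y^\delta\in Y$. Then $$D_\xi(x^\delta_{\alpha_*},x^\dagger)\to 0\qquad\text{as }\delta\to0 .$$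
   Context: $X$ is a Banach space, $Y$ a Hilbert space, $A:X\to Y$ a continuous linear operator with adjoint $A^*:Y\to X^*$. The functional $\mathcal R:X\to\mathbb R\cup\{\infty\}$ is convex, proper, coercive and weak-$*$ lower semicontinuous (these properties ensure that the minimisers below exist). $\alpha_{\max}>0$ is fixed. $y\in Y$ denotes exact data and $x^\dagger\in X$ an $\mathcal R$-minimising solution: $Ax^\dagger=y$ and $\mathcal R(x^\dagger)=\min\{\mathcal R(x):Ax=y\}$. For $\alpha\in(0,\alpha_{\max})$ and $y^\delta\in Y$, $x_\alpha^\delta\in\operatorname{argmin}_{x\in X}\frac12\|Ax-y^\delta\|^2+\alpha\mathcal R(x)$ and $x_\alpha\in\operatorname{argmin}_{x\in X}\frac12\|Ax-y\|^2+\alpha\mathcal R(x)$. Residuals: $p_\alpha^\delta=y^\delta-Ax_\alpha^\delta$, $p_\alpha=y-Ax_\alpha$, $\Delta p_\alpha=p_\alpha^\delta-p_\alpha$. Subgradient of $\mathcal R$ at $x_\alpha$: $\xi_\alpha=-\frac1\alpha A^*(Ax_\alpha-y)$. For $\eta\in\partial\mathcal R(x_2)$ the Bregman distance is $D_\eta(x_1,x_2)=\mathcal R(x_1)-\mathcal R(x_2)-\langle\eta,x_1-x_2\rangle_{X^*\times X}$. The rule selects a global minimiser $\alpha_*$ over $(0,\alpha_{\max})$, taken to exist. *)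

theory Defs
  imports "HOL-Analysis.Analysis"
begin

text \<open>
  The topological dual \<open>X\<^sup>*\<close> of a real normed space is the type of bounded linear functionals
  \<open>'x \<Rightarrow>\<^sub>L real\<close>.  Functionals into \<open>\<real> \<union> {\<infinity>}\<close> are \<open>ereal\<close>-valued functions that
  avoid \<open>-\<infinity>\<close> (part of \<open>proper\<close> below).
\<close>

definition proper :: "('x \<Rightarrow> ereal) \<Rightarrow> bool" where
  "proper R \<longleftrightarrow> (\<forall>x. R x \<noteq> -\<infinity>) \<and> (\<exists>x. R x \<noteq> \<infinity>)"

definition econvex :: "('x::real_vector \<Rightarrow> ereal) \<Rightarrow> bool" where
  "econvex R \<longleftrightarrow> (\<forall>x y. \<forall>t\<in>{0..1::real}.
     R ((1 - t) *\<^sub>R x + t *\<^sub>R y) \<le> ereal (1 - t) * R x + ereal t * R y)"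

definition coercive :: "('x::real_normed_vector \<Rightarrow> ereal) \<Rightarrow> bool" where
  "coercive R \<longleftrightarrow> (R \<longlongrightarrow> \<infinity>) at_infinity"

text \<open>
  A weak-* topology on \<open>X\<close> presupposes a predual.  It is given here by an isometric isomorphism
  \<open>J\<close> of \<open>X\<close> onto the dual of a Banach space \<open>Z\<close>.  On functionals,
  \<^const>\<open>strong_operator_topology\<close> is the topology of pointwise convergence, that is, the
  weak-* topology of the dual of \<open>Z\<close>.
\<close>

definition is_predual ::
  "('x::real_normed_vector \<Rightarrow>\<^sub>L ('z::real_normed_vector \<Rightarrow>\<^sub>L real)) \<Rightarrow> bool" where
  "is_predual J \<longleftrightarrow> (\<forall>x. norm (J x) = norm x) \<and> surj (blinfun_apply J)"

definition weak_star_topology ::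
  "('x::real_normed_vector \<Rightarrow>\<^sub>L ('z::real_normed_vector \<Rightarrow>\<^sub>L real)) \<Rightarrow> 'x topology" where
  "weak_star_topology J = pullback_topology UNIV (blinfun_apply J) strong_operator_topology"

definition lower_semicontinuous_in :: "'x topology \<Rightarrow> ('x \<Rightarrow> ereal) \<Rightarrow> bool" where
  "lower_semicontinuous_in T R \<longleftrightarrow> (\<forall>c. closedin T {x \<in> topspace T. R x \<le> c})"

text \<open>
  The adjoint \<open>A\<^sup>* : Y \<rightarrow> X\<^sup>*\<close>, with \<open>Y\<close> identified with its dual:
  \<open>(A\<^sup>* w) x = w \<bullet> A x\<close>.
\<close>

definition dual_adjoint ::
  "('x::real_normed_vector \<Rightarrow>\<^sub>L 'y::real_inner) \<Rightarrow> 'y \<Rightarrow> ('x \<Rightarrow>\<^sub>L real)" where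
  "dual_adjoint A w = blinfun_inner_right w o\<^sub>L A"

definition subdifferential ::
  "('x::real_normed_vector \<Rightarrow> ereal) \<Rightarrow> 'x \<Rightarrow> ('x \<Rightarrow>\<^sub>L real) set" where
  "subdifferential R x =
     {\<eta> :: 'x \<Rightarrow>\<^sub>L real. \<bar>R x\<bar> \<noteq> \<infinity> \<and> (\<forall>z. R z \<ge> R x + ereal (\<eta> (z - x)))}"

text \<open>Only meaningful if \<open>\<eta> \<in> subdifferential R x2\<close>; then \<open>R x2\<close> is finite.\<close>

definition bregman ::
  "('x::real_normed_vector \<Rightarrow> ereal) \<Rightarrow> ('x \<Rightarrow>\<^sub>L real) \<Rightarrow> 'x \<Rightarrow> 'x \<Rightarrow> ereal" where
  "bregman R \<eta> x1 x2 = R x1 - R x2 - ereal (\<eta> (x1 - x2))"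

definition tikhonov ::
  "('x::real_normed_vector \<Rightarrow>\<^sub>L 'y::real_inner) \<Rightarrow> ('x \<Rightarrow> ereal) \<Rightarrow> real \<Rightarrow> 'y \<Rightarrow> 'x \<Rightarrow> ereal"
  where
  "tikhonov A R \<alpha> v x = ereal (1/2 * (norm (A x - v))\<^sup>2) + ereal \<alpha> * R x"

definition tikhonov_minimiser ::
  "('x::real_normed_vector \<Rightarrow>\<^sub>L 'y::real_inner) \<Rightarrow> ('x \<Rightarrow> ereal) \<Rightarrow> real \<Rightarrow> 'y \<Rightarrow> 'x \<Rightarrow> bool"
  where
  "tikhonov_minimiser A R \<alpha> v x \<longleftrightarrow> is_arg_min (tikhonov A R \<alpha> v) (\<lambda>_. True) x"

definition R_minimising_solution ::
  "('x::real_normed_vector \<Rightarrow>\<^sub>L 'y::real_inner) \<Rightarrow> ('x \<Rightarrow> ereal) \<Rightarrow> 'y \<Rightarrow> 'x \<Rightarrow> bool" where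
  "R_minimising_solution A R y x \<longleftrightarrow> is_arg_min R (\<lambda>x. A x = y) x"

text \<open>
  \<open>xr \<alpha> v\<close> is the regularised solution for the parameter \<open>\<alpha>\<close> and the data \<open>v\<close>.
\<close>

definition heuristic_discrepancy_choice ::
  "('x::real_normed_vector \<Rightarrow>\<^sub>L 'y::real_inner) \<Rightarrow> (real \<Rightarrow> 'y \<Rightarrow> 'x) \<Rightarrow> real \<Rightarrow> 'y \<Rightarrow> real \<Rightarrow> bool"
  where
  "heuristic_discrepancy_choice A xr \<alpha>max v \<alpha> \<longleftrightarrow>
     is_arg_min (\<lambda>\<beta>. 1 / \<beta> * (norm (v - A (xr \<beta> v)))\<^sup>2) (\<lambda>\<beta>. \<beta> \<in> {0<..<\<alpha>max}) \<alpha>"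

end

theory Submission
  imports Defs
begin

text \<open>
  Write \<open>p = y - A x\<^sub>\<alpha>\<close> and \<open>p\<^sup>\<delta> = y\<^sup>\<delta> - A x\<^sub>\<alpha>\<^sup>\<delta>\<close>.  By optimality, \<open>A\<^sup>* (p / \<alpha>)\<close> and
  \<open>A\<^sup>* (p\<^sup>\<delta> / \<alpha>)\<close> are subgradients of \<open>R\<close> at \<open>x\<^sub>\<alpha>\<close> and \<open>x\<^sub>\<alpha>\<^sup>\<delta>\<close>, so monotonicity of the subdifferential
  gives \<open>\<parallel>p\<parallel> \<le> \<alpha> \<parallel>w\<parallel>\<close> and \<open>\<parallel>p\<^sup>\<delta> - p\<parallel> \<le> \<delta>\<close>.  Comparing \<open>\<alpha>\<^sub>*\<close> with the competitor \<open>\<alpha> = \<delta>\<close> shows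
  \<open>\<parallel>p\<^sup>\<delta>\<parallel>\<^sup>2 / \<alpha>\<^sub>* \<le> (\<parallel>w\<parallel> + 1)\<^sup>2 \<delta>\<close>.  Auto-regularisation bounds \<open>R x\<^sub>\<alpha>\<^sup>\<delta> - R x\<^sub>\<alpha>\<close> by
  \<open>2 \<parallel>w\<parallel> \<delta> + C \<parallel>p\<^sup>\<delta> - p\<parallel>\<^sup>2 / \<alpha>\<^sub>*\<close>, and the last term tends to 0 because
  \<open>\<parallel>p\<parallel>\<^sup>2 / \<alpha>\<^sub>* \<le> \<parallel>w\<parallel> \<parallel>p\<parallel> \<le> \<parallel>w\<parallel> (\<parallel>p\<^sup>\<delta>\<parallel> + \<delta>)\<close>.  Since \<open>R x\<^sub>\<alpha> \<le> R x\<^sup>\<dagger>\<close>, this controls the Bregman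
  distance; in particular \<open>\<alpha>\<^sub>*\<close> itself need not tend to 0.
\<close>

lemma dual_adjoint_apply: "dual_adjoint A w x = w \<bullet> A x"
  by (simp add: dual_adjoint_def)

section \<open>Optimality condition for Tikhonov minimisers\<close>

lemma tikhonov_minimiser_le:
  "tikhonov_minimiser A R \<alpha> v x \<Longrightarrow> tikhonov A R \<alpha> v x \<le> tikhonov A R \<alpha> v z"
  by (simp add: tikhonov_minimiser_def is_arg_min_linorder)

lemma tikhonov_minimiser_finite:
  assumes "proper R" "\<alpha> > 0" "tikhonov_minimiser A R \<alpha> v x"
  shows "\<bar>R x\<bar> \<noteq> \<infinity>"
proof -
  obtain z where "R z \<noteq> \<infinity>" using assms(1) by (auto simp: proper_def)
  moreover have "R z \<noteq> -\<infinity>" "R x \<noteq> -\<infinity>" using assms(1) by (auto simp: proper_def)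
  ultimately show ?thesis
    using tikhonov_minimiser_le[OF assms(3), of z] assms(2)
    by (cases "R z"; cases "R x") (auto simp: tikhonov_def)
qed

text \<open>Divide by \<open>t\<close> and let \<open>t\<close> decrease to 0. Only
  \<open>t \<le> 1\<close> is assumed, since \<open>t\<close> will be the weight of a convex
  combination.\<close>

lemma nonneg_of_quadratic_nonneg:
  fixes a b :: real
  assumes "\<And>t. 0 < t \<Longrightarrow> t \<le> 1 \<Longrightarrow> t * a + t\<^sup>2 * b \<ge> 0"
  shows "a \<ge> 0"
proof -
  have "((\<lambda>t. a + t * b) \<longlongrightarrow> a + 0 * b) (at_right 0)"
    by (intro tendsto_intros)
  moreover have "\<forall>\<^sub>F t in at_right 0. a + t * b \<ge> 0"
    using eventually_at_right_real[OF zero_less_one]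
  proof eventually_elim
    case (elim t)
    with assms[of t] have "0 \<le> t * (a + t * b)"
      by (simp add: algebra_simps power2_eq_square)
    with elim show ?case by (simp add: zero_le_mult_iff)
  qed
  ultimately show ?thesis
    using tendsto_lowerbound[of "\<lambda>t. a + t * b" "a + 0 * b" "at_right 0" 0] by simp
qed

text \<open>Compare \<open>x\<close> with the points of the segment towards \<open>z\<close>.
  Convexity makes the penalty affine in \<open>t\<close>, and the data term is quadratic in
  \<open>t\<close>, so minimality forces the coefficient of \<open>t\<close> to be nonnegative.
  Divided by \<alpha>, this is the subgradient inequality.\<close>

lemma tikhonov_minimiser_subgradient:
  assumes conv: "econvex R" and proper: "proper R" and \<alpha>: "\<alpha> > 0"
    and opt: "tikhonov_minimiser A R \<alpha> v x"
  shows "dual_adjoint A ((1 / \<alpha>) *\<^sub>R (v - A x)) \<in> subdifferential R x"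
proof -
  have fin: "\<bar>R x\<bar> \<noteq> \<infinity>" using tikhonov_minimiser_finite[OF proper \<alpha> opt] .
  then obtain rx where rx: "R x = ereal rx" by (cases "R x") auto
  have "R z \<ge> R x + ereal (dual_adjoint A ((1 / \<alpha>) *\<^sub>R (v - A x)) (z - x))" for z
  proof (cases "R z")
    case (real rz)
    define h where "h = A (z - x)"
    define p where "p = v - A x"
    have "0 \<le> t * (\<alpha> * (rz - rx) - p \<bullet> h) + t\<^sup>2 * (1 / 2 * (norm h)\<^sup>2)"
      if t: "0 < t" "t \<le> 1" for t
    proof -
      define u where "u = (1 - t) *\<^sub>R x + t *\<^sub>R z"
      have Ru: "R u \<le> ereal ((1 - t) * rx + t * rz)"
        using conv t unfolding econvex_def u_def
        by (metis rx real atLeastAtMost_iff less_imp_le times_ereal.simps(1) plus_ereal.simps(1))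
      have "R u \<noteq> -\<infinity>" using proper by (auto simp: proper_def)
      with Ru obtain ru where ru: "R u = ereal ru" by (cases "R u") auto
      have Au: "A u - v = t *\<^sub>R h - p"
        by (simp add: u_def h_def p_def blinfun.bilinear_simps algebra_simps)
      have "1/2 * (norm (A x - v))\<^sup>2 + \<alpha> * rx \<le> 1/2 * (norm (A u - v))\<^sup>2 + \<alpha> * ru"
        using tikhonov_minimiser_le[OF opt, of u] by (simp add: tikhonov_def rx ru)
      also have "\<dots> \<le> 1/2 * (norm (A u - v))\<^sup>2 + \<alpha> * ((1 - t) * rx + t * rz)"
        using Ru ru \<alpha> by simp
      also have "(norm (A u - v))\<^sup>2 = t\<^sup>2 * (norm h)\<^sup>2 - 2 * t * (p \<bullet> h) + (norm p)\<^sup>2"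
        unfolding Au power2_norm_eq_inner
        by (simp add: inner_diff inner_commute power2_eq_square algebra_simps)
      finally show ?thesis
        by (simp add: p_def norm_minus_commute algebra_simps)
    qed
    then have "\<alpha> * (rz - rx) - p \<bullet> h \<ge> 0" by (rule nonneg_of_quadratic_nonneg)
    with \<alpha> have "rx + (1 / \<alpha>) * (p \<bullet> h) \<le> rz" by (simp add: field_simps)
    then show ?thesis
      by (simp add: rx real dual_adjoint_apply p_def h_def)
  next
    case MInf
    then show ?thesis using proper by (auto simp: proper_def)
  qed simp
  with fin show ?thesis by (auto simp: subdifferential_def)
qed

section \<open>Residual estimates from monotonicity\<close>

lemma subdifferential_monotone:
  assumes "\<eta>1 \<in> subdifferential R x1" "\<eta>2 \<in> subdifferential R x2"
  shows "\<eta>2 (x1 - x2) \<le> \<eta>1 (x1 - x2)"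
proof -
  have 1: "R x2 \<ge> R x1 + ereal (\<eta>1 (x2 - x1))" and 2: "R x1 \<ge> R x2 + ereal (\<eta>2 (x1 - x2))"
    and "\<bar>R x1\<bar> \<noteq> \<infinity>" "\<bar>R x2\<bar> \<noteq> \<infinity>"
    using assms by (auto simp: subdifferential_def)
  then obtain r1 r2 where "R x1 = ereal r1" "R x2 = ereal r2"
    by (cases "R x1"; cases "R x2") auto
  with 1 2 have "r2 \<ge> r1 + \<eta>1 (x2 - x1)" "r1 \<ge> r2 + \<eta>2 (x1 - x2)" by auto
  then show ?thesis by (simp add: blinfun.diff_right)
qed

lemma norm_le_of_square_le_inner:
  fixes a b :: "'a::real_inner"
  assumes "(norm a)\<^sup>2 \<le> a \<bullet> b"
  shows "norm a \<le> norm b"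
proof (cases "a = 0")
  case False
  have "norm a * norm a \<le> norm a * norm b"
    using assms norm_cauchy_schwarz[of a b] by (simp add: power2_eq_square)
  with False show ?thesis by simp
qed simp

text \<open>Monotonicity is applied between \<open>x\<close> and \<open>xd\<close>, whose
  subgradients come from optimality and from the source condition. As \<open>A (x - xd)\<close> is
  minus the residual, the square of the residual norm appears.\<close>

lemma residual_le_source:
  assumes "econvex R" "proper R" "\<alpha> > 0" "tikhonov_minimiser A R \<alpha> y x" "A xd = y"
    and "dual_adjoint A w \<in> subdifferential R xd"
  shows "norm (y - A x) \<le> \<alpha> * norm w"
proof -
  have "w \<bullet> A (x - xd) \<le> ((1 / \<alpha>) *\<^sub>R (y - A x)) \<bullet> A (x - xd)"
    using subdifferential_monotone[OF tikhonov_minimiser_subgradient[OF assms(1-4)] assms(6)]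
    by (simp only: dual_adjoint_apply)
  moreover have "A (x - xd) = - (y - A x)" by (simp add: blinfun.diff_right assms(5))
  ultimately have "(norm (y - A x))\<^sup>2 / \<alpha> \<le> (y - A x) \<bullet> w"
    by (simp only: inner_minus_right inner_scaleR_left power2_norm_eq_inner)
      (simp add: inner_commute)
  with assms(3) have "(norm (y - A x))\<^sup>2 \<le> (y - A x) \<bullet> (\<alpha> *\<^sub>R w)"
    by (simp add: field_simps)
  from norm_le_of_square_le_inner[OF this] assms(3) show ?thesis by simp
qed

text \<open>For fixed \<alpha> the map from data to residual is firmly nonexpansive: monotonicity
  yields \<open>(norm d)\<^sup>2 \<le> d \<bullet> (v - v')\<close>.\<close>

lemma residual_difference_le:
  assumes "econvex R" "proper R" "\<alpha> > 0"
    and "tikhonov_minimiser A R \<alpha> v x" "tikhonov_minimiser A R \<alpha> v' x'"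
  shows "norm ((v - A x) - (v' - A x')) \<le> norm (v - v')"
proof -
  define d where "d = (v - A x) - (v' - A x')"
  have "((1 / \<alpha>) *\<^sub>R (v' - A x')) \<bullet> A (x - x') \<le> ((1 / \<alpha>) *\<^sub>R (v - A x)) \<bullet> A (x - x')"
    using subdifferential_monotone[OF tikhonov_minimiser_subgradient[OF assms(1-4)]
        tikhonov_minimiser_subgradient[OF assms(1-3) assms(5)]]
    by (simp only: dual_adjoint_apply)
  with assms(3) have "(v' - A x') \<bullet> A (x - x') \<le> (v - A x) \<bullet> A (x - x')"
    by (simp add: divide_le_cancel)
  then have "0 \<le> d \<bullet> A (x - x')" by (simp add: d_def inner_diff_left)
  also have "A (x - x') = (v - v') - d" by (simp add: d_def blinfun.diff_right)
  finally have "(norm d)\<^sup>2 \<le> d \<bullet> (v - v')"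
    by (simp add: inner_diff_right power2_norm_eq_inner)
  from norm_le_of_square_le_inner[OF this] show ?thesis by (simp add: d_def)
qed

lemma tikhonov_minimiser_exact_le:
  assumes "proper R" "\<alpha> > 0" "tikhonov_minimiser A R \<alpha> y x" "A xd = y"
  shows "R x \<le> R xd"
proof -
  have "\<bar>R x\<bar> \<noteq> \<infinity>" using tikhonov_minimiser_finite[OF assms(1-3)] .
  then obtain r where r: "R x = ereal r" by (cases "R x") auto
  show ?thesis
  proof (cases "R xd")
    case (real s)
    have "1/2 * (norm (A x - y))\<^sup>2 + \<alpha> * r \<le> \<alpha> * s"
      using tikhonov_minimiser_le[OF assms(3), of xd] assms(4)
      by (simp add: tikhonov_def r real)
    then have "\<alpha> * r \<le> \<alpha> * s" using zero_le_power2[of "norm (A x - y)"] by linarith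
    with assms(2) show ?thesis by (simp add: r real)
  next
    case MInf
    then show ?thesis using assms(1) by (auto simp: proper_def)
  qed simp
qed

section \<open>Bounds for the heuristic functional and the Bregman distance\<close>

lemma heuristic_value_le:
  fixes A :: "'x::real_normed_vector \<Rightarrow>\<^sub>L 'y::real_inner"
  assumes "econvex R" "proper R" "A xd = y" "dual_adjoint A w \<in> subdifferential R xd"
    and xv: "\<And>\<beta>. \<beta> \<in> {0<..<\<alpha>max} \<Longrightarrow> tikhonov_minimiser A R \<beta> v (xr \<beta> v)"
    and \<delta>: "\<delta> \<in> {0<..<\<alpha>max}" "norm (v - y) \<le> \<delta>"
    and x0: "tikhonov_minimiser A R \<delta> y x0"
    and choice: "heuristic_discrepancy_choice A xr \<alpha>max v \<alpha>"
  shows "(norm (v - A (xr \<alpha> v)))\<^sup>2 / \<alpha> \<le> (norm w + 1)\<^sup>2 * \<delta>"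
proof -
  have \<delta>0: "\<delta> > 0" using \<delta> by simp
  have "norm (y - A x0) \<le> \<delta> * norm w"
    by (rule residual_le_source[OF assms(1,2) \<delta>0 x0 assms(3,4)])
  moreover have "norm ((v - A (xr \<delta> v)) - (y - A x0)) \<le> norm (v - y)"
    by (rule residual_difference_le[OF assms(1,2) \<delta>0 xv[OF \<delta>(1)] x0])
  \<comment> \<open>At parameter \<delta> the source part and the noise part of the residual are
    both of order \<delta>. Squaring and dividing by \<delta> leaves one factor \<delta>.\<close>
  ultimately have "norm (v - A (xr \<delta> v)) \<le> \<delta> * (norm w + 1)"
    using \<delta>(2) norm_triangle_sub[of "v - A (xr \<delta> v)" "y - A x0"]
    by (simp add: algebra_simps)
  then have "(norm (v - A (xr \<delta> v)))\<^sup>2 \<le> (\<delta> * (norm w + 1))\<^sup>2" by (rule power_mono) simp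
  then have "(norm (v - A (xr \<delta> v)))\<^sup>2 / \<delta> \<le> (\<delta> * (norm w + 1))\<^sup>2 / \<delta>"
    using \<delta>0 by (simp add: divide_right_mono)
  also have "\<dots> = (norm w + 1)\<^sup>2 * \<delta>"
    using \<delta>0 by (simp add: power2_eq_square)
  finally show ?thesis
    using choice \<delta>(1)
    by (force simp: heuristic_discrepancy_choice_def is_arg_min_linorder)
qed

text \<open>The bound contains \<alpha> only through \<open>\<pi>\<^sup>2 / \<alpha>\<close>, the
  quantity that the rule minimises, so no lower bound on \<alpha> in terms of \<delta> is
  required.\<close>

lemma bregman_auto_regularisation_le:
  fixes A :: "'x::real_normed_vector \<Rightarrow>\<^sub>L 'y::real_inner"
  assumes "econvex R" "proper R" "A xd = y"
    and \<xi>: "dual_adjoint A w \<in> subdifferential R xd"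
    and \<alpha>: "\<alpha> > 0" and C: "C \<ge> 0"
    and xv: "tikhonov_minimiser A R \<alpha> v xv"
    and x0: "tikhonov_minimiser A R \<alpha> y x0"
    and noise: "norm (v - y) \<le> \<delta>"
    and auto_reg: "bregman R (- (1 / \<alpha>) *\<^sub>R dual_adjoint A (A x0 - y)) xv x0
        \<le> ereal (C * ((norm ((v - A xv) - (y - A x0)))\<^sup>2 / \<alpha>))"
  defines "\<pi> \<equiv> norm (v - A xv)"
  shows "bregman R (dual_adjoint A w) xv xd
    \<le> ereal (norm w * (3 * \<delta> + \<pi>) + 2 * C * (\<pi>\<^sup>2 / \<alpha> + norm w * (\<pi> + \<delta>)))"
proof -
  define p where "p = y - A x0"
  define d where "d = (v - A xv) - p"
  have p: "norm p \<le> \<alpha> * norm w"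
    using residual_le_source[OF assms(1,2) \<alpha> x0 assms(3) \<xi>] by (simp add: p_def)
  have d: "norm d \<le> norm (v - y)"
    using residual_difference_le[OF assms(1,2) \<alpha> xv x0] by (simp add: d_def p_def)
  have "\<bar>R xv\<bar> \<noteq> \<infinity>" "\<bar>R x0\<bar> \<noteq> \<infinity>" "\<bar>R xd\<bar> \<noteq> \<infinity>"
    using tikhonov_minimiser_finite[OF assms(2) \<alpha> xv] tikhonov_minimiser_finite[OF assms(2) \<alpha> x0] \<xi>
    by (simp_all add: subdifferential_def)
  then obtain rv r0 rd where r: "R xv = ereal rv" "R x0 = ereal r0" "R xd = ereal rd"
    by (cases "R xv"; cases "R x0"; cases "R xd") auto
  have r0: "r0 \<le> rd"
    using tikhonov_minimiser_exact_le[OF assms(2) \<alpha> x0 assms(3)] by (simp add: r)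
  have "A (xv - x0) = (v - y) - d"
    by (simp add: d_def p_def blinfun.diff_right)
  moreover have "(- (1 / \<alpha>) *\<^sub>R dual_adjoint A (A x0 - y)) (xv - x0) = (1 / \<alpha>) * (p \<bullet> A (xv - x0))"
    by (simp add: p_def dual_adjoint_apply blinfun.scaleR_left blinfun.minus_left
        inner_diff_left diff_divide_distrib)
  ultimately have "rv \<le> r0 + (1 / \<alpha>) * (p \<bullet> ((v - y) - d)) + C * ((norm d)\<^sup>2 / \<alpha>)"
    using auto_reg by (simp add: bregman_def r d_def p_def)
  \<comment> \<open>The factor \<alpha> in the bound for \<open>norm p\<close> cancels
    \<open>1 / \<alpha>\<close>.\<close>
  moreover have "(1 / \<alpha>) * (p \<bullet> ((v - y) - d)) \<le> norm w * (2 * \<delta>)"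
  proof -
    have "p \<bullet> ((v - y) - d) \<le> norm p * norm ((v - y) - d)" by (rule norm_cauchy_schwarz)
    also have "\<dots> \<le> (\<alpha> * norm w) * (2 * \<delta>)"
      using p d noise norm_triangle_ineq4[of "v - y" d] \<alpha> by (intro mult_mono) auto
    finally show ?thesis using \<alpha> by (simp add: field_simps)
  qed
  \<comment> \<open>Using \<open>norm d \<le> \<delta>\<close> here would leave the uncontrolled
    term \<open>\<delta>\<^sup>2 / \<alpha>\<close>. Instead \<open>d\<close> is split into its two
    residuals. In \<open>(norm p)\<^sup>2\<close> one factor is bounded by
    \<open>\<alpha> * norm w\<close>, which absorbs \<open>1 / \<alpha>\<close>, and the other by
    \<open>\<pi> + \<delta>\<close>, which is small.\<close>
  moreover have "C * ((norm d)\<^sup>2 / \<alpha>) \<le> C * (2 * (\<pi>\<^sup>2 / \<alpha> + norm w * (\<pi> + \<delta>)))"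
  proof (rule mult_left_mono[OF _ C])
    have "norm p \<le> \<pi> + \<delta>"
      using norm_triangle_ineq4[of "v - A xv" d] d noise by (simp add: d_def \<pi>_def)
    then have "norm p * norm p \<le> (\<alpha> * norm w) * (\<pi> + \<delta>)"
      using p \<alpha> by (intro mult_mono) auto
    moreover have "norm d \<le> \<pi> + norm p"
      unfolding d_def \<pi>_def by (rule norm_triangle_ineq4)
    then have "(norm d)\<^sup>2 \<le> (\<pi> + norm p)\<^sup>2" by (intro power_mono) auto
    ultimately have "(norm d)\<^sup>2 \<le> 2 * \<pi>\<^sup>2 + 2 * (\<alpha> * norm w * (\<pi> + \<delta>))"
      using sum_squares_bound[of \<pi> "norm p"] by (simp add: power2_eq_square algebra_simps)
    then have "(norm d)\<^sup>2 / \<alpha> \<le> (2 * \<pi>\<^sup>2 + 2 * (\<alpha> * norm w * (\<pi> + \<delta>))) / \<alpha>"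
      using \<alpha> by (simp add: divide_right_mono)
    also have "\<dots> = 2 * (\<pi>\<^sup>2 / \<alpha> + norm w * (\<pi> + \<delta>))"
      using \<alpha> by (simp add: field_simps)
    finally show "(norm d)\<^sup>2 / \<alpha> \<le> 2 * (\<pi>\<^sup>2 / \<alpha> + norm w * (\<pi> + \<delta>))" .
  qed
  moreover have "- (w \<bullet> A (xv - xd)) \<le> norm w * (\<delta> + \<pi>)"
  proof -
    have "- (w \<bullet> A (xv - xd)) = w \<bullet> ((v - A xv) - (v - y))"
      by (simp add: blinfun.diff_right assms(3) inner_diff_right)
    also have "\<dots> \<le> norm w * norm ((v - A xv) - (v - y))" by (rule norm_cauchy_schwarz)
    also have "\<dots> \<le> norm w * (\<delta> + \<pi>)"
      using norm_triangle_ineq4[of "v - A xv" "v - y"] noise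
      by (intro mult_left_mono) (auto simp: \<pi>_def)
    finally show ?thesis .
  qed
  ultimately have "rv - rd - w \<bullet> A (xv - xd)
      \<le> norm w * (3 * \<delta> + \<pi>) + 2 * C * (\<pi>\<^sup>2 / \<alpha> + norm w * (\<pi> + \<delta>))"
    using r0 by (simp add: algebra_simps)
  then show ?thesis by (simp add: bregman_def r dual_adjoint_apply)
qed

lemma bregman_nonneg:
  assumes "\<eta> \<in> subdifferential R x2"
  shows "bregman R \<eta> x1 x2 \<ge> 0"
proof -
  have "R x1 \<ge> R x2 + ereal (\<eta> (x1 - x2))" "\<bar>R x2\<bar> \<noteq> \<infinity>"
    using assms by (auto simp: subdifferential_def)
  then show ?thesis
    by (cases "R x1"; cases "R x2") (auto simp: bregman_def)
qed

theorem theorem2: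
  fixes A :: "'x::banach \<Rightarrow>\<^sub>L 'y::{real_inner, complete_space}"
    and J :: "'x \<Rightarrow>\<^sub>L ('z::banach \<Rightarrow>\<^sub>L real)"
    and R :: "'x \<Rightarrow> ereal"
    and \<alpha>max C :: real
    and y w :: 'y
    and xdag :: 'x
    and \<xi> :: "'x \<Rightarrow>\<^sub>L real"
    and x\<delta> :: "real \<Rightarrow> 'y \<Rightarrow> 'x"
    and x0 :: "real \<Rightarrow> 'x"
    and \<alpha>star :: "'y \<Rightarrow> real"
    and y\<delta> :: "real \<Rightarrow> 'y"
  assumes predual: "is_predual J"
    and R: "econvex R" "proper R" "coercive R"
      "lower_semicontinuous_in (weak_star_topology J) R"
    and \<alpha>max: "\<alpha>max > 0"
    and xdag: "R_minimising_solution A R y xdag"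
    and x\<delta>: "\<And>\<alpha> v. \<alpha> \<in> {0<..<\<alpha>max} \<Longrightarrow> tikhonov_minimiser A R \<alpha> v (x\<delta> \<alpha> v)"
    and x0: "\<And>\<alpha>. \<alpha> \<in> {0<..<\<alpha>max} \<Longrightarrow> tikhonov_minimiser A R \<alpha> y (x0 \<alpha>)"
    and source: "\<xi> = dual_adjoint A w" "\<xi> \<in> subdifferential R xdag"
    and noise: "\<forall>\<^sub>F \<delta> in at_right 0. norm (y\<delta> \<delta> - y) \<le> \<delta>"
    and \<alpha>star: "\<forall>\<^sub>F \<delta> in at_right 0.
      heuristic_discrepancy_choice A x\<delta> \<alpha>max (y\<delta> \<delta>) (\<alpha>star (y\<delta> \<delta>))"
    and nonzero: "\<forall>\<^sub>F \<delta> in at_right 0.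
      norm (A (x\<delta> (\<alpha>star (y\<delta> \<delta>)) (y\<delta> \<delta>)) - y\<delta> \<delta>) \<noteq> 0"
    and C: "C > 0"
    and auto_regularisation: "\<And>\<alpha> v. \<alpha> \<in> {0<..<\<alpha>max} \<Longrightarrow>
      bregman R (- (1 / \<alpha>) *\<^sub>R dual_adjoint A (A (x0 \<alpha>) - y)) (x\<delta> \<alpha> v) (x0 \<alpha>)
        \<le> ereal (C * ((norm ((v - A (x\<delta> \<alpha> v)) - (y - A (x0 \<alpha>))))\<^sup>2 / \<alpha>))"
  shows "((\<lambda>\<delta>. bregman R \<xi> (x\<delta> (\<alpha>star (y\<delta> \<delta>)) (y\<delta> \<delta>)) xdag) \<longlongrightarrow> 0) (at_right 0)"
proof -
  have Axd: "A xdag = y"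
    using xdag by (simp add: R_minimising_solution_def is_arg_min_def)
  have \<xi>: "dual_adjoint A w \<in> subdifferential R xdag" using source by simp
  define k where "k = (norm w + 1)\<^sup>2"
  \<comment> \<open>\<open>s\<close> will bound the residual at the selected parameter, using only
    that this parameter lies below \<open>\<alpha>max\<close>; \<open>g\<close> is the Bregman bound
    with the residual replaced by \<open>s\<close>.\<close>
  define s where "s \<delta> = sqrt (\<alpha>max * (k * \<delta>))" for \<delta>
  define g where "g \<delta> = norm w * (3 * \<delta> + s \<delta>) + 2 * C * (k * \<delta> + norm w * (s \<delta> + \<delta>))" for \<delta>
  \<comment> \<open>Eventually \<open>\<delta> < \<alpha>max\<close>, so that \<delta> itself is an
    admissible competitor.\<close>
  have bound: "\<forall>\<^sub>F \<delta> in at_right 0.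
      bregman R \<xi> (x\<delta> (\<alpha>star (y\<delta> \<delta>)) (y\<delta> \<delta>)) xdag \<le> ereal (g \<delta>)"
    using noise \<alpha>star eventually_at_right_real[OF \<alpha>max]
  proof eventually_elim
    case (elim \<delta>)
    define v where "v = y\<delta> \<delta>"
    define \<alpha> where "\<alpha> = \<alpha>star v"
    define \<pi> where "\<pi> = norm (v - A (x\<delta> \<alpha> v))"
    have \<alpha>: "\<alpha> \<in> {0<..<\<alpha>max}"
      using elim(2) by (simp add: heuristic_discrepancy_choice_def is_arg_min_def \<alpha>_def v_def)
    then have \<alpha>0: "\<alpha> > 0" by simp
    have \<psi>: "\<pi>\<^sup>2 / \<alpha> \<le> k * \<delta>"
      unfolding \<pi>_def k_def
      by (rule heuristic_value_le[OF R(1,2) Axd \<xi> x\<delta> elim(3) _ x0[OF elim(3)]])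
        (use elim in \<open>auto simp: v_def \<alpha>_def\<close>)
    have "\<pi>\<^sup>2 \<le> \<alpha> * (k * \<delta>)" using \<psi> \<alpha>0 by (simp add: field_simps)
    also have "\<dots> \<le> \<alpha>max * (k * \<delta>)"
      using \<alpha> elim(3) by (intro mult_right_mono) (auto simp: k_def)
    finally have \<pi>: "\<pi> \<le> s \<delta>" unfolding s_def by (rule real_le_rsqrt)
    have "bregman R (dual_adjoint A w) (x\<delta> \<alpha> v) xdag
        \<le> ereal (norm w * (3 * \<delta> + \<pi>) + 2 * C * (\<pi>\<^sup>2 / \<alpha> + norm w * (\<pi> + \<delta>)))"
      unfolding \<pi>_def
      by (rule bregman_auto_regularisation_le[OF R(1,2) Axd \<xi> \<alpha>0 _ x\<delta>[OF \<alpha>] x0[OF \<alpha>] _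
            auto_regularisation[OF \<alpha>]])
        (use C elim in \<open>auto simp: v_def\<close>)
    also have "\<dots> \<le> ereal (g \<delta>)"
      unfolding g_def ereal_less_eq using \<psi> \<pi> C
      by (intro add_mono mult_left_mono) auto
    finally show ?case by (simp add: source(1) \<alpha>_def v_def)
  qed
  have "(g \<longlongrightarrow> g 0) (at_right 0)"
    unfolding g_def s_def by (intro tendsto_intros)
  moreover have "g 0 = 0" by (simp add: g_def s_def)
  ultimately have "((\<lambda>\<delta>. ereal (g \<delta>)) \<longlongrightarrow> 0) (at_right 0)"
    by (simp add: zero_ereal_def)
  then show ?thesis
    \<comment> \<open>The lower bound 0 is the subgradient inequality for \<xi> at
      \<open>xdag\<close>.\<close>
    by (intro tendsto_sandwich[OF _ bound tendsto_const])
      (auto intro: always_eventually bregman_nonneg[OF source(2)])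
qed

end
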